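(* Let $\{P_n(x)\}_{n\ge 1}$ and the coefficients $b_i(n)$ be as defined in the context, and let $m=\lfloor\frac{n-1}{2}\rfloor$. (1) For odd $n$, the numbers $b_j(n)/n$, $j=0,\dots,m-1$, are integers; moreover, for odd $n\ge3$, $b_i(n)=n\big(b_i(n-1)+b_{i-1}(n-1)\big)$ for $i=1,\dots,m-1$. (2) For even $n\ge4$, $2b_i(n)=b_i(n-1)+b_{i-1}(n-1)+m!\binom{m}{i}$ for $i=1,\dots,m-1$.
   Context: The sequence $\{P_n(x)\}_{n\ge1}$ of rational functions of $x$ is defined by $P_1=P_2=1$ and, for $n\ge 2$: if $n$ is odd, $4(2x+n)P_{n+1}(x)=2(x+n)P_n(x)+(2x+n)P_n(x+1)+(4x+n)\ell_n(x)$; if $n$ is even, $4P_{n+1}(x)=4(x+n)P_n(x)+2(2x+n+1)P_n(x+1)+(4x+n)\ell_{n-1}(x)$. Here for odd $r\ge1$, $\ell_r(x)=\prod_{j=1}^{(r-1)/2}(x+j)$ (the empty product equals $1$). Each $P_n$ is a polynomial of degree $m(n)=\lfloor\frac{n-1}{2}\rfloor$; its coefficients in the binomial basis are defined by $P_n(x)=\sum_{i=0}^{m(n)}b_i(n)\binom{x}{m(n)-i}$ (so $b_i(n-1)$ refers to the expansion of $P_{n-1}$ with respect to its own degree $m(n-1)$). *)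

theory Defs
  imports "HOL-Computational_Algebra.Computational_Algebra"
begin

text \<open>Rational functions in one variable over the rationals are elements of the fraction field
  \<^typ>\<open>rat poly fract\<close>.\<close>

definition ratfun_X :: "rat poly fract" where
  "ratfun_X = to_fract [:0, 1:]"

text \<open>The substitution \<open>f(x) \<mapsto> f(x + 1)\<close>, acting on numerator and denominator; by the next lemma
  the result does not depend on the representation of \<open>f\<close> as a fraction.\<close>

definition ratfun_shift :: "rat poly fract \<Rightarrow> rat poly fract" where
  "ratfun_shift f = (THE g. \<exists>p q. q \<noteq> 0 \<and> f = Fract p q \<and>
     g = Fract (pcompose p [:1, 1:]) (pcompose q [:1, 1:]))"

lemma ratfun_shift_Fract:
  assumes "q \<noteq> 0"
  shows "ratfun_shift (Fract p q) = Fract (pcompose p [:1, 1:]) (pcompose q [:1, 1:])"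
  unfolding ratfun_shift_def
proof (rule the_equality)
  fix g
  assume "\<exists>p' q'. q' \<noteq> 0 \<and> Fract p q = Fract p' q' \<and>
    g = Fract (pcompose p' [:1, 1:]) (pcompose q' [:1, 1:])"
  then obtain p' q' where q': "q' \<noteq> 0" and eq: "Fract p q = Fract p' q'"
    and g: "g = Fract (pcompose p' [:1, 1:]) (pcompose q' [:1, 1:])"
    by blast
  have "p' * q = p * q'"
    using eq q' assms by (simp add: eq_fract)
  then have "pcompose p' [:1, 1:] * pcompose q [:1, 1:] = pcompose p [:1, 1:] * pcompose q' [:1, 1:]"
    by (metis pcompose_mult)
  moreover have "pcompose q [:1, 1:] \<noteq> 0" "pcompose q' [:1, 1:] \<noteq> 0"
    using q' assms by (auto simp: pcompose_eq_0_iff)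
  ultimately show "g = Fract (pcompose p [:1, 1:]) (pcompose q [:1, 1:])"
    by (simp add: g eq_fract)
qed (use assms in blast)

lemma ratfun_shift_to_fract: "ratfun_shift (to_fract p) = to_fract (pcompose p [:1, 1:])"
  by (simp add: to_fract_def ratfun_shift_Fract pcompose_1)

text \<open>For odd \<open>r\<close>, \<open>\<ell>\<^sub>r(x) = (x + 1) \<cdots> (x + (r - 1) / 2)\<close>.\<close>

definition ell :: "nat \<Rightarrow> rat poly fract" where
  "ell r = (\<Prod>j=1..(r - 1) div 2. ratfun_X + of_nat j)"

text \<open>The recurrence is solved for \<open>P\<^sub>n\<^sub>+\<^sub>1\<close> by dividing in the field of rational functions; the
  lemmas below recover the fraction-free form. The value at index 0 is a dummy.\<close>

fun Pseq :: "nat \<Rightarrow> rat poly fract" where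
  "Pseq 0 = 0"
| "Pseq (Suc 0) = 1"
| "Pseq (Suc (Suc 0)) = 1"
| "Pseq (Suc (Suc (Suc k))) =
    (let n = Suc (Suc k); x = ratfun_X in
     if odd n then
       (2 * (x + of_nat n) * Pseq n + (2 * x + of_nat n) * ratfun_shift (Pseq n)
         + (4 * x + of_nat n) * ell n) / (4 * (2 * x + of_nat n))
     else
       (4 * (x + of_nat n) * Pseq n + 2 * (2 * x + of_nat n + 1) * ratfun_shift (Pseq n)
         + (4 * x + of_nat n) * ell (n - 1)) / 4)"

lemma Pseq_initial: "Pseq 1 = 1" "Pseq 2 = 1"
  by (simp_all add: numeral_2_eq_2)

lemma to_fract_of_nat: "of_nat n = to_fract (of_nat n)"
  by (induction n) simp_all

lemma to_fract_numeral: "numeral k = to_fract (numeral k)"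
  using to_fract_of_nat[of "numeral k"] by simp

lemma Pseq_rec_odd:
  assumes "n \<ge> 2" "odd n"
  shows "4 * (2 * ratfun_X + of_nat n) * Pseq (n + 1) =
           2 * (ratfun_X + of_nat n) * Pseq n + (2 * ratfun_X + of_nat n) * ratfun_shift (Pseq n)
           + (4 * ratfun_X + of_nat n) * ell n"
proof -
  define k where "k = n - 2"
  have n: "n = Suc (Suc k)"
    using assms(1) by (simp add: k_def)
  have eq: "4 * (2 * ratfun_X + of_nat n) = to_fract [:4 * of_nat n, 8:]"
  proof -
    have "4 * (2 * ratfun_X + of_nat n) = to_fract (4 * (2 * [:0, 1:] + of_nat n))"
      by (simp only: to_fract_mult to_fract_add to_fract_of_nat to_fract_numeral ratfun_X_def)
    also have "4 * (2 * [:0, 1:] + of_nat n) = [:4 * of_nat n, 8 :: rat:]"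
      by (simp add: numeral_poly of_nat_poly)
    finally show ?thesis .
  qed
  have "4 * (2 * ratfun_X + of_nat n) \<noteq> 0"
    unfolding eq to_fract_eq_0_iff by simp
  then show ?thesis
    using assms(2) by (simp add: n Let_def del: of_nat_Suc)
qed

lemma Pseq_rec_even:
  assumes "n \<ge> 2" "even n"
  shows "4 * Pseq (n + 1) =
           4 * (ratfun_X + of_nat n) * Pseq n + 2 * (2 * ratfun_X + of_nat n + 1) * ratfun_shift (Pseq n)
           + (4 * ratfun_X + of_nat n) * ell (n - 1)"
proof -
  define k where "k = n - 2"
  have n: "n = Suc (Suc k)"
    using assms(1) by (simp add: k_def)
  have "(4 :: rat poly fract) \<noteq> 0"
    by (simp add: to_fract_numeral)
  then show ?thesis
    using assms(2) by (simp add: n Let_def del: of_nat_Suc)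
qed

definition mdeg :: "nat \<Rightarrow> nat" where
  "mdeg n = (n - 1) div 2"

text \<open>The polynomial \<open>x (x - 1) \<cdots> (x - k + 1) / k!\<close>, that is, \<open>x\<close> choose \<open>k\<close>.\<close>

definition binom_poly :: "nat \<Rightarrow> rat poly" where
  "binom_poly k = smult (1 / fact k) (\<Prod>i<k. [:- of_nat i, 1:])"

lemma poly_binom_poly: "poly (binom_poly k) x = x gchoose k"
  by (simp add: binom_poly_def poly_prod gbinomial_prod_rev atLeast0LessThan)

text \<open>\<open>bcoef i n\<close> is \<open>b\<^sub>i(n)\<close>. The coefficient sequence is made unique by requiring it to vanish
  beyond \<^term>\<open>mdeg n\<close>. That such a sequence exists (so that the rational function \<^term>\<open>Pseq n\<close> is a
  polynomial of degree at most \<^term>\<open>mdeg n\<close>) is not built into the definition.\<close>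

definition bcoef :: "nat \<Rightarrow> nat \<Rightarrow> rat" where
  "bcoef i n = (THE c. (\<forall>j>mdeg n. c j = 0) \<and>
     Pseq n = to_fract (\<Sum>j=0..mdeg n. smult (c j) (binom_poly (mdeg n - j)))) i"

end

theory Submission
  imports Defs
begin

text \<open>The shift \<open>P\<^sub>n(x + 1)\<close> can be eliminated from the recurrence. For odd \<open>n\<close>,
  \<open>(2x + n) P\<^sub>n(x + 1) = 2(x + n) P\<^sub>n(x) - n \<ell>\<^sub>n(x)\<close>,
  and with this identity the recurrence becomes \<open>2 P\<^sub>n\<^sub>+\<^sub>1(x) = P\<^sub>n(x + 1) + \<ell>\<^sub>n(x)\<close> and
  \<open>P\<^sub>n\<^sub>+\<^sub>2(x) = (x + n + 1) P\<^sub>n(x + 1) + 2 \<ell>\<^sub>n\<^sub>+\<^sub>2(x)\<close>,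
  which in turn gives the identity at \<open>n + 2\<close>. It follows that
  \<open>P\<^sub>n(x + 1) - P\<^sub>n(x) = n P\<^sub>n\<^sub>-\<^sub>1(x + 1)\<close> for odd \<open>n \<ge> 3\<close>.
  Since the coefficient of \<open>x\<close> choose \<open>k\<close> is the \<open>k\<close>-th forward difference at \<open>0\<close>, both
  coefficient recurrences can be read off from these relations. For integrality, \<open>P\<^sub>n\<^sub>+\<^sub>1\<close> takes
  integer values at natural numbers for odd \<open>n\<close>, because
  \<open>P\<^sub>n\<^sub>+\<^sub>3(x) = (x + n + 2) P\<^sub>n\<^sub>+\<^sub>1(x + 1) - ((n + 1) / 2) \<ell>\<^sub>n(x + 1) + \<ell>\<^sub>n\<^sub>+\<^sub>2(x + 1)\<close>.\<close>

subsection \<open>Newton coefficients\<close>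

definition pshift :: "rat poly \<Rightarrow> rat poly" where
  "pshift p = pcompose p [:1, 1:]"

definition pdiff :: "rat poly \<Rightarrow> rat poly" where
  "pdiff p = pshift p - p"

lemma poly_pshift [simp]: "poly (pshift p) x = poly p (x + 1)"
  by (simp add: pshift_def poly_pcompose add.commute)

lemma degree_pshift [simp]: "degree (pshift p) = degree p"
  by (simp add: pshift_def degree_pcompose)

lemma pdiff_add: "pdiff (p + q) = pdiff p + pdiff q"
  and pdiff_smult: "pdiff (smult c p) = smult c (pdiff p)"
  by (simp_all add: pdiff_def pshift_def pcompose_add pcompose_smult smult_diff_right)

lemma pdiff_0: "pdiff 0 = 0"
  by (simp add: pdiff_def pshift_def)

text \<open>The \<open>k\<close>-th forward difference at 0. The recursion differences first and
  evaluates last, so inductions on \<open>k\<close> generalize over \<open>p\<close>.\<close>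

fun newton_coeff :: "rat poly \<Rightarrow> nat \<Rightarrow> rat" where
  "newton_coeff p 0 = poly p 0"
| "newton_coeff p (Suc k) = newton_coeff (pdiff p) k"

lemma newton_coeff_0 [simp]: "newton_coeff 0 k = 0"
  by (induction k) (simp_all add: pdiff_0)

lemma newton_coeff_add [simp]: "newton_coeff (p + q) k = newton_coeff p k + newton_coeff q k"
  by (induction k arbitrary: p q) (simp_all add: pdiff_add)

lemma newton_coeff_smult [simp]: "newton_coeff (smult c p) k = c * newton_coeff p k"
  by (induction k arbitrary: p) (simp_all add: pdiff_smult)

lemma newton_coeff_sum:
  "newton_coeff (\<Sum>i\<in>A. f i) k = (\<Sum>i\<in>A. newton_coeff (f i) k)"
  by (induction A rule: infinite_finite_induct) simp_all

text \<open>The shift is the identity plus the difference operator. This is the source of the sums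
  b_i + b_(i-1) in both recurrences.\<close>

lemma newton_coeff_pshift:
  "newton_coeff (pshift p) k = newton_coeff p k + newton_coeff p (Suc k)"
proof -
  have "pshift p = p + pdiff p"
    by (simp add: pdiff_def)
  then show ?thesis
    by simp
qed

lemma newton_coeff_Ints:
  assumes "\<And>x::nat. poly p (of_nat x) \<in> \<int>"
  shows "newton_coeff p k \<in> \<int>"
  using assms
proof (induction k arbitrary: p)
  case 0
  from 0[of 0] show ?case by simp
next
  case (Suc k)
  have "poly (pdiff p) (of_nat x) \<in> \<int>" for x :: nat
    using Suc.prems[of x] Suc.prems[of "Suc x"] by (simp add: pdiff_def add.commute)
  then show ?case
    using Suc.IH by simp
qed

lemma pdiff_binom_poly:
  "pdiff (binom_poly 0) = 0" "pdiff (binom_poly (Suc k)) = binom_poly k"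
proof -
  show "pdiff (binom_poly 0) = 0"
    by (simp add: binom_poly_def pdiff_def pshift_def pcompose_smult pcompose_1)
  show "pdiff (binom_poly (Suc k)) = binom_poly k"
    by (rule poly_ext) (simp add: pdiff_def poly_binom_poly gbinomial_Suc_Suc)
qed

lemma newton_coeff_binom_poly: "newton_coeff (binom_poly k) i = (if i = k then 1 else 0)"
proof (induction i arbitrary: k)
  case 0
  show ?case by (cases k) (simp_all add: poly_binom_poly)
next
  case (Suc i)
  then show ?case by (cases k) (simp_all add: pdiff_binom_poly)
qed

text \<open>Forward differences are dual to the binomial basis, so the coefficients of such a sum
  are determined by the polynomial. The reversed index matches \<open>bcoef\<close>.\<close>

lemma newton_coeff_binom_sum:
  assumes "j \<le> m"
  shows "newton_coeff (\<Sum>j=0..m. smult (c j) (binom_poly (m - j))) (m - j) = c j"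
proof -
  have "newton_coeff (\<Sum>j=0..m. smult (c j) (binom_poly (m - j))) (m - j)
      = (\<Sum>i=0..m. if i = j then c j else 0)"
    unfolding newton_coeff_sum
    by (rule sum.cong) (use assms in \<open>auto simp: newton_coeff_binom_poly\<close>)
  then show ?thesis
    using assms by simp
qed

section \<open>Expansion in the binomial basis\<close>

lemma degree_binom_poly: "degree (binom_poly k) = k"
  and coeff_binom_poly: "coeff (binom_poly k) k = 1 / fact k"
proof -
  have "degree (\<Prod>i<k. [:- of_nat i, 1 :: rat:]) = k"
    by (subst degree_prod_eq_sum_degree) auto
  moreover have "lead_coeff (\<Prod>i<k. [:- of_nat i, 1 :: rat:]) = 1"
    by (subst lead_coeff_prod) simp
  ultimately show "degree (binom_poly k) = k" "coeff (binom_poly k) k = 1 / fact k"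
    by (simp_all add: binom_poly_def)
qed

lemma binom_poly_expansion:
  assumes "degree p \<le> m"
  shows "\<exists>c. p = (\<Sum>j\<le>m. smult (c j) (binom_poly j))"
  using assms
proof (induction m arbitrary: p)
  case 0
  then obtain a where "p = [:a:]"
    using degree_eq_zeroE by auto
  then show ?case
    by (auto simp: binom_poly_def intro: exI[of _ "\<lambda>_. a"])
next
  case (Suc m)
  \<comment> \<open>The leading coefficient of \<open>binom_poly (Suc m)\<close> is
    \<open>1 / fact (Suc m)\<close>, so this multiple cancels the top term of
    \<open>p\<close>.\<close>
  define a where "a = coeff p (Suc m) * fact (Suc m)"
  define q where "q = p - smult a (binom_poly (Suc m))"
  have "degree q \<le> Suc m"
    unfolding q_def using Suc.prems
    by (intro degree_diff_le) (auto intro: order.trans[OF degree_smult_le] simp: degree_binom_poly)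
  moreover have "coeff q (Suc m) = 0"
    by (simp add: q_def a_def coeff_binom_poly del: fact_Suc)
  ultimately have "degree q \<le> m"
    by (metis degree_0 le_Suc_eq leading_coeff_0_iff zero_le)
  then obtain c where c: "q = (\<Sum>j\<le>m. smult (c j) (binom_poly j))"
    using Suc.IH by blast
  have "p = (\<Sum>j\<le>Suc m. smult ((c(Suc m := a)) j) (binom_poly j))"
    using c by (simp add: q_def algebra_simps)
  then show ?case
    by blast
qed

lemma newton_expansion:
  assumes "degree p \<le> m"
  shows "p = (\<Sum>j=0..m. smult (newton_coeff p (m - j)) (binom_poly (m - j)))"
proof -
  obtain c where "p = (\<Sum>j\<le>m. smult (c j) (binom_poly j))"
    using binom_poly_expansion[OF assms] by blast
  also have "\<dots> = (\<Sum>j=0..m. smult (c (m - j)) (binom_poly (m - j)))"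
    unfolding atLeast0AtMost
    by (rule sum.reindex_bij_witness[of _ "\<lambda>j. m - j" "\<lambda>j. m - j"]) auto
  finally have p: "p = (\<Sum>j=0..m. smult (c (m - j)) (binom_poly (m - j)))" .
  have "newton_coeff p (m - j) = c (m - j)" if "j \<le> m" for j
    by (subst p) (rule newton_coeff_binom_sum[OF that])
  then show ?thesis
    using p by (simp cong: sum.cong_simp)
qed

text \<open>Resolves the description in \<open>bcoef\<close>: the Newton expansion gives existence,
  duality with the binomial basis gives uniqueness.\<close>

lemma bcoef_eq_newton_coeff:
  assumes P: "Pseq n = to_fract p" and "degree p \<le> mdeg n" and "j \<le> mdeg n"
  shows "bcoef j n = newton_coeff p (mdeg n - j)"
proof -
  \<comment> \<open>Truncated differences such as \<open>mdeg n - j\<close> collapse to 0 for large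
    \<open>j\<close>, so the required vanishing beyond \<open>mdeg n\<close> is imposed
    explicitly.\<close>
  let ?c = "\<lambda>j. if j \<le> mdeg n then newton_coeff p (mdeg n - j) else 0"
  have "bcoef j n = ?c j"
    unfolding bcoef_def
  proof (rule fun_cong[OF the_equality])
    have "p = (\<Sum>j=0..mdeg n. smult (?c j) (binom_poly (mdeg n - j)))"
      using newton_expansion[OF assms(2)] by (simp cong: sum.cong_simp)
    then show "(\<forall>j>mdeg n. ?c j = 0) \<and>
        Pseq n = to_fract (\<Sum>j=0..mdeg n. smult (?c j) (binom_poly (mdeg n - j)))"
      using P by simp
  next
    fix c
    assume c: "(\<forall>j>mdeg n. c j = 0) \<and>
        Pseq n = to_fract (\<Sum>j=0..mdeg n. smult (c j) (binom_poly (mdeg n - j)))"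
    then have "p = (\<Sum>j=0..mdeg n. smult (c j) (binom_poly (mdeg n - j)))"
      using P by (simp del: to_fract_sum)
    then show "c = ?c"
      using c newton_coeff_binom_sum[of _ "mdeg n" c] by (auto simp: fun_eq_iff)
  qed
  then show ?thesis
    using assms(3) by simp
qed

subsection \<open>Closed form of the recurrence\<close>

text \<open>The polynomial behind \<open>ell (2 * k + 1)\<close>, indexed by its number of
  factors.\<close>

definition ell_poly :: "nat \<Rightarrow> rat poly" where
  "ell_poly k = (\<Prod>j=1..k. [:of_nat j, 1:])"

text \<open>\<open>odd_poly k\<close> is \<open>P\<^sub>2\<^sub>k\<^sub>+\<^sub>1\<close> and \<open>even_poly k\<close> is \<open>P\<^sub>2\<^sub>k\<^sub>+\<^sub>2\<close>.\<close>

fun odd_poly :: "nat \<Rightarrow> rat poly" where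
  "odd_poly 0 = 1"
| "odd_poly (Suc k) = [:2 * of_nat k + 2, 1:] * pshift (odd_poly k) + 2 * ell_poly (Suc k)"

definition even_poly :: "nat \<Rightarrow> rat poly" where
  "even_poly k = smult (1 / 2) (pshift (odd_poly k) + ell_poly k)"

lemma ell_poly_0 [simp]: "ell_poly 0 = 1"
  by (simp add: ell_poly_def)

lemma ell_poly_Suc: "ell_poly (Suc k) = ell_poly k * [:of_nat k + 1, 1:]"
  by (simp add: ell_poly_def add.commute)

lemma poly_ell_poly_Suc: "poly (ell_poly (Suc k)) x = (x + of_nat k + 1) * poly (ell_poly k) x"
  by (simp add: ell_poly_Suc algebra_simps)

text \<open>Splits off the first factor x + 1 of the product instead of the last; the remaining
  factors are those of \<open>ell_poly k\<close> at x + 1.\<close>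

lemma ell_poly_Suc_shift: "poly (ell_poly (Suc k)) x = (x + 1) * poly (ell_poly k) (x + 1)"
proof (induction k)
  case 0
  show ?case by (simp add: poly_ell_poly_Suc)
next
  case (Suc k)
  have "poly (ell_poly (Suc (Suc k))) x = (x + of_nat k + 2) * poly (ell_poly (Suc k)) x"
    by (subst poly_ell_poly_Suc) (simp add: add.commute)
  also have "\<dots> = (x + 1) * ((x + 1 + of_nat k + 1) * poly (ell_poly k) (x + 1))"
    unfolding Suc.IH by (simp add: algebra_simps)
  finally show ?case
    by (simp only: poly_ell_poly_Suc[of k "x + 1"])
qed

lemma ell_eq: "ell (2 * k + 1) = to_fract (ell_poly k)"
  by (induction k)
    (simp_all add: ell_def ell_poly_Suc ratfun_X_def to_fract_of_nat of_nat_poly add.commute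
      flip: to_fract_add to_fract_mult)

lemma odd_poly_shift:
  "(2 * x + 2 * of_nat k + 1) * poly (odd_poly k) (x + 1)
    = 2 * (x + 2 * of_nat k + 1) * poly (odd_poly k) x - (2 * of_nat k + 1) * poly (ell_poly k) x"
proof (induction k arbitrary: x)
  case 0
  show ?case by simp
next
  case (Suc k)
  let ?K = "of_nat k :: rat" and ?q = "\<lambda>i. poly (odd_poly k) (x + i)"
    and ?l = "poly (ell_poly k) (x + 1)"
  have IH: "(2 * x + 2 * ?K + 3) * ?q 2 = 2 * (x + 2 * ?K + 2) * ?q 1 - (2 * ?K + 1) * ?l"
    using Suc.IH[of "x + 1"] by (simp add: algebra_simps)
  have ell: "poly (ell_poly (Suc k)) (x + 1) = (x + ?K + 2) * ?l"
    by (simp add: poly_ell_poly_Suc)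
  have 0: "poly (odd_poly (Suc k)) x = (x + 2 * ?K + 2) * ?q 1 + 2 * ((x + 1) * ?l)"
    by (simp add: ell_poly_Suc_shift algebra_simps)
  have 1: "poly (odd_poly (Suc k)) (x + 1) = (x + 2 * ?K + 3) * ?q 2 + 2 * ((x + ?K + 2) * ?l)"
    using ell by (simp add: algebra_simps)
  \<comment> \<open>This is x + 2k + 3 times \<open>IH\<close>; the remaining multiples of
    \<open>?l\<close> agree identically.\<close>
  have "(2 * x + 2 * ?K + 3) * ((x + 2 * ?K + 3) * ?q 2 + 2 * ((x + ?K + 2) * ?l))
      = 2 * (x + 2 * ?K + 3) * ((x + 2 * ?K + 2) * ?q 1 + 2 * ((x + 1) * ?l))
        - (2 * ?K + 3) * ((x + 1) * ?l)"
    using IH by algebra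
  then show ?case
    unfolding 0 1 ell_poly_Suc_shift by (simp add: algebra_simps)
qed

text \<open>The recursion writes both values through \<open>odd_poly k\<close> at x + 1 and x + 2;
  half of the shift identity at x + 1 then removes the value at x + 1.\<close>

lemma pdiff_odd_poly_Suc:
  "pdiff (odd_poly (Suc k)) = smult (of_nat (2 * k + 3)) (pshift (even_poly k))"
proof (rule poly_ext)
  fix x :: rat
  let ?K = "of_nat k :: rat" and ?q = "\<lambda>i. poly (odd_poly k) (x + i)"
    and ?l = "poly (ell_poly k) (x + 1)"
  have A: "(2 * x + 2 * ?K + 3) * ?q 2 = 2 * (x + 2 * ?K + 2) * ?q 1 - (2 * ?K + 1) * ?l"
    using odd_poly_shift[of "x + 1" k] by (simp add: algebra_simps)
  have ell: "poly (ell_poly (Suc k)) (x + 1) = (x + ?K + 2) * ?l"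
    by (simp add: poly_ell_poly_Suc)
  have "poly (pdiff (odd_poly (Suc k))) x
      = (x + 2 * ?K + 3) * ?q 2 + 2 * ((x + ?K + 2) * ?l)
        - ((x + 2 * ?K + 2) * ?q 1 + 2 * ((x + 1) * ?l))"
    using ell by (simp add: pdiff_def ell_poly_Suc_shift[of k x] algebra_simps)
  also have "\<dots> = (2 * ?K + 3) * ((?q 2 + ?l) / 2)"
    using A by algebra
  finally show "poly (pdiff (odd_poly (Suc k))) x
      = poly (smult (of_nat (2 * k + 3)) (pshift (even_poly k))) x"
    by (simp add: even_poly_def add.assoc)
qed

text \<open>The defining recurrence at n = 2k + 1. Replacing 2(x + n) P_n(x) by the shift identity
  makes the right-hand side divisible by 2x + n.\<close>

lemma rec_odd_poly:
  "4 * (2 * [:0, 1:] + of_nat (2 * k + 1)) * even_poly k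
    = 2 * ([:0, 1:] + of_nat (2 * k + 1)) * odd_poly k
      + (2 * [:0, 1:] + of_nat (2 * k + 1)) * pshift (odd_poly k)
      + (4 * [:0, 1:] + of_nat (2 * k + 1)) * ell_poly k"
proof (rule poly_ext, goal_cases)
  case (1 x)
  show ?case
    using odd_poly_shift[of x k] by (simp add: even_poly_def algebra_simps)
qed

text \<open>The defining recurrence at n = 2k + 2, where \<open>ell (n - 1)\<close> is
  \<open>ell_poly k\<close>.\<close>

lemma rec_even_poly:
  "4 * odd_poly (Suc k)
    = 4 * ([:0, 1:] + of_nat (2 * k + 2)) * even_poly k
      + 2 * (2 * [:0, 1:] + of_nat (2 * k + 2) + 1) * pshift (even_poly k)
      + (4 * [:0, 1:] + of_nat (2 * k + 2)) * ell_poly k"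
proof (rule poly_ext, goal_cases)
  case (1 x)
  let ?K = "of_nat k :: rat" and ?q = "\<lambda>i. poly (odd_poly k) (x + i)"
    and ?l = "\<lambda>i. poly (ell_poly k) (x + i)"
  have A: "(2 * x + 2 * ?K + 3) * ?q 2 = 2 * (x + 2 * ?K + 2) * ?q 1 - (2 * ?K + 1) * ?l 1"
    using odd_poly_shift[of "x + 1" k] by (simp add: algebra_simps)
  \<comment> \<open>Two ways to split \<open>ell_poly (Suc k)\<close>: by its first and by its last
    factor.\<close>
  have l: "(x + 1) * ?l 1 = (x + ?K + 1) * ?l 0"
    using ell_poly_Suc_shift[of k x] by (simp add: ell_poly_Suc algebra_simps)
  have "4 * ((x + 2 * ?K + 2) * ?q 1 + 2 * ((x + 1) * ?l 1))
      = 4 * (x + 2 * ?K + 2) * ((?q 1 + ?l 0) / 2)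
        + 2 * (2 * x + 2 * ?K + 3) * ((?q 2 + ?l 1) / 2) + (4 * x + 2 * ?K + 2) * ?l 0"
    using A l by algebra
  then show ?case
    by (simp add: even_poly_def ell_poly_Suc_shift add.assoc add_divide_distrib algebra_simps)
qed

section \<open>Transfer to the sequence of rational functions\<close>

lemma Pseq_odd_step:
  assumes "Pseq (2 * k + 2) = to_fract (even_poly k)"
  shows "Pseq (2 * k + 3) = to_fract (odd_poly (Suc k))"
proof -
  let ?n = "2 * k + 2"
  have n: "?n \<ge> 2" "even ?n" and ell: "ell (?n - 1) = to_fract (ell_poly k)"
    using ell_eq[of k] by simp_all
  have "4 * Pseq (?n + 1)
      = 4 * (ratfun_X + of_nat ?n) * to_fract (even_poly k)
        + 2 * (2 * ratfun_X + of_nat ?n + 1) * to_fract (pshift (even_poly k))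
        + (4 * ratfun_X + of_nat ?n) * to_fract (ell_poly k)"
    by (simp only: Pseq_rec_even[OF n] assms ell ratfun_shift_to_fract pshift_def)
  also have "\<dots> = to_fract (4 * odd_poly (Suc k))"
    unfolding rec_even_poly ratfun_X_def to_fract_of_nat to_fract_numeral
    by (simp only: to_fract_add to_fract_mult to_fract_1)
  also have "\<dots> = 4 * to_fract (odd_poly (Suc k))"
    by (simp only: to_fract_mult to_fract_numeral)
  finally have "4 * Pseq (?n + 1) = 4 * to_fract (odd_poly (Suc k))" .
  moreover have "(4 :: rat poly fract) \<noteq> 0"
    by (simp add: to_fract_numeral)
  ultimately have "Pseq (?n + 1) = to_fract (odd_poly (Suc k))"
    by (simp only: mult_cancel_left) simp
  moreover have "?n + 1 = 2 * k + 3"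
    by simp
  ultimately show ?thesis
    by (simp only:)
qed

lemma Pseq_even_step:
  assumes "Pseq (2 * k + 3) = to_fract (odd_poly (Suc k))"
  shows "Pseq (2 * k + 4) = to_fract (even_poly (Suc k))"
proof -
  let ?n = "2 * Suc k + 1"
  have n: "?n \<ge> 2" "odd ?n" "?n = 2 * k + 3" "?n + 1 = 2 * k + 4"
    by simp_all
  then have P: "Pseq ?n = to_fract (odd_poly (Suc k))"
    using assms by (simp only:)
  have "4 * (2 * ratfun_X + of_nat ?n) * Pseq (?n + 1)
      = 2 * (ratfun_X + of_nat ?n) * to_fract (odd_poly (Suc k))
        + (2 * ratfun_X + of_nat ?n) * to_fract (pshift (odd_poly (Suc k)))
        + (4 * ratfun_X + of_nat ?n) * to_fract (ell_poly (Suc k))"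
    by (simp only: Pseq_rec_odd[OF n(1,2)] P ell_eq ratfun_shift_to_fract pshift_def)
  also have "\<dots> = to_fract (4 * (2 * [:0, 1:] + of_nat ?n) * even_poly (Suc k))"
    unfolding rec_odd_poly ratfun_X_def to_fract_of_nat to_fract_numeral
    by (simp only: to_fract_add to_fract_mult)
  also have "\<dots> = 4 * (2 * ratfun_X + of_nat ?n) * to_fract (even_poly (Suc k))"
    unfolding ratfun_X_def to_fract_of_nat to_fract_numeral
    by (simp only: to_fract_add to_fract_mult)
  finally have "4 * (2 * ratfun_X + of_nat ?n) * Pseq (?n + 1)
      = 4 * (2 * ratfun_X + of_nat ?n) * to_fract (even_poly (Suc k))" .
  \<comment> \<open>The common factor may be cancelled because it is a polynomial with leading
    coefficient 8.\<close>
  moreover have "4 * (2 * ratfun_X + of_nat ?n) \<noteq> 0"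
  proof -
    have "4 * (2 * ratfun_X + of_nat ?n) = to_fract (4 * (2 * [:0, 1:] + of_nat ?n))"
      unfolding ratfun_X_def to_fract_of_nat to_fract_numeral
      by (simp only: to_fract_add to_fract_mult)
    also have "4 * (2 * [:0, 1:] + of_nat ?n) = [:4 * of_nat ?n, 8 :: rat:]"
      by (simp only: numeral_poly of_nat_poly) simp
    finally show ?thesis
      by simp
  qed
  ultimately have "Pseq (?n + 1) = to_fract (even_poly (Suc k))"
    by (simp only: mult_cancel_left) simp
  then show ?thesis
    by (simp only: n(4))
qed

lemma Pseq_eq:
  "Pseq (2 * k + 1) = to_fract (odd_poly k) \<and> Pseq (2 * k + 2) = to_fract (even_poly k)"
proof (induction k)
  case 0
  \<comment> \<open>P_2 is prescribed, since the recurrence starts only at n = 2; the closed form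
    has to be checked against it.\<close>
  have "even_poly 0 = 1"
    by (rule poly_ext) (simp add: even_poly_def)
  then show ?case
    using Pseq_initial by simp
next
  case (Suc k)
  have odd: "Pseq (2 * k + 3) = to_fract (odd_poly (Suc k))"
    using Suc.IH by (intro Pseq_odd_step) simp
  have "2 * Suc k + 1 = 2 * k + 3" "2 * Suc k + 2 = 2 * k + 4"
    by simp_all
  then show ?case
    using odd Pseq_even_step[OF odd] by (simp only:)
qed

section \<open>Degree bounds and the coefficients b_i(n) as Newton coefficients\<close>

lemma degree_ell_poly: "degree (ell_poly k) \<le> k"
proof (induction k)
  case (Suc k)
  then show ?case
    unfolding ell_poly_Suc by (intro order.trans[OF degree_mult_le]) simp
qed simp

lemma degree_odd_poly: "degree (odd_poly k) \<le> k"
proof (induction k)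
  case (Suc k)
  have "degree ([:2 * of_nat k + 2, 1:] * pshift (odd_poly k)) \<le> Suc k"
    by (intro order.trans[OF degree_mult_le]) (use Suc in simp)
  moreover have "degree (2 * ell_poly (Suc k)) \<le> Suc k"
    by (intro order.trans[OF degree_mult_le]) (use degree_ell_poly[of "Suc k"] in simp)
  ultimately show ?case
    by (simp only: odd_poly.simps degree_add_le)
qed simp

lemma degree_even_poly: "degree (even_poly k) \<le> k"
  unfolding even_poly_def
  by (intro order.trans[OF degree_smult_le] degree_add_le)
    (simp_all add: degree_odd_poly degree_ell_poly)

lemma bcoef_odd: "j \<le> m \<Longrightarrow> bcoef j (2 * m + 1) = newton_coeff (odd_poly m) (m - j)"
  using bcoef_eq_newton_coeff[of "2 * m + 1" "odd_poly m" j] Pseq_eq[of m] degree_odd_poly[of m]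
  by (simp add: mdeg_def)

lemma bcoef_even: "j \<le> m \<Longrightarrow> bcoef j (2 * m + 2) = newton_coeff (even_poly m) (m - j)"
  using bcoef_eq_newton_coeff[of "2 * m + 2" "even_poly m" j] Pseq_eq[of m] degree_even_poly[of m]
  by (simp add: mdeg_def)

subsection \<open>The coefficient recurrences\<close>

lemma newton_coeff_odd_poly_Suc:
  "newton_coeff (odd_poly (Suc m)) (Suc k)
    = of_nat (2 * m + 3) * (newton_coeff (even_poly m) k + newton_coeff (even_poly m) (Suc k))"
  by (simp only: newton_coeff.simps(2) pdiff_odd_poly_Suc newton_coeff_smult newton_coeff_pshift)

lemma pdiff_ell_poly_Suc: "pdiff (ell_poly (Suc k)) = smult (of_nat (Suc k)) (pshift (ell_poly k))"
proof (rule poly_ext)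
  fix x :: rat
  have "poly (ell_poly (Suc k)) (x + 1) = (x + 1 + of_nat k + 1) * poly (ell_poly k) (x + 1)"
    by (simp add: ell_poly_Suc algebra_simps)
  then show "poly (pdiff (ell_poly (Suc k))) x
      = poly (smult (of_nat (Suc k)) (pshift (ell_poly k))) x"
    by (simp add: pdiff_def ell_poly_Suc_shift[of k x] algebra_simps)
qed

text \<open>\<open>ell_poly m\<close> is m! times (x + m choose m), and its coefficients are those
  of Vandermonde's identity. The induction on \<open>m\<close> uses Pascal's rule.\<close>

lemma newton_coeff_ell_poly: "newton_coeff (ell_poly m) k = fact m * of_nat (m choose k)"
proof (induction m arbitrary: k)
  case 0
  show ?case
    by (cases k) (simp_all add: pdiff_def pshift_def pcompose_1)
next
  case (Suc m)
  show ?case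
  proof (cases k)
    case 0
    then show ?thesis
      using Suc.IH[of 0] by (simp add: ell_poly_Suc algebra_simps)
  next
    case (Suc l)
    then show ?thesis
      unfolding Suc newton_coeff.simps(2)[of "ell_poly (Suc m)"] pdiff_ell_poly_Suc
        newton_coeff_smult newton_coeff_pshift Suc.IH
      by (simp add: algebra_simps)
  qed
qed

lemma newton_coeff_even_poly:
  "2 * newton_coeff (even_poly m) k
    = newton_coeff (odd_poly m) k + newton_coeff (odd_poly m) (Suc k) + fact m * of_nat (m choose k)"
  by (simp only: even_poly_def newton_coeff_smult newton_coeff_add newton_coeff_pshift
      newton_coeff_ell_poly) simp

section \<open>Integer values\<close>

lemma ell_poly_Ints: "poly (ell_poly k) (of_nat x) \<in> \<int>"
  by (induction k) (simp_all add: ell_poly_Suc)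

lemma even_poly_Ints: "poly (even_poly k) (of_nat x) \<in> \<int>"
proof (induction k arbitrary: x)
  case 0
  show ?case by (simp add: even_poly_def)
next
  case (Suc k)
  let ?K = "of_nat k :: rat" and ?x = "of_nat x :: rat"
  \<comment> \<open>By definition \<open>odd_poly k\<close> at x + 2 is twice
    \<open>even_poly k\<close> minus \<open>ell_poly k\<close>, both at x + 1. The half-integral
    multiples -(x + 2k + 3)/2 and (x + 1)/2 of \<open>ell_poly k\<close> at x + 1 combine to -(k +
    1).\<close>
  have "poly (even_poly (Suc k)) ?x
      = (?x + 2 * ?K + 3) * poly (even_poly k) (of_nat (Suc x))
        - (?K + 1) * poly (ell_poly k) (of_nat (Suc x)) + poly (ell_poly (Suc k)) (of_nat (Suc x))"
    by (simp add: even_poly_def ell_poly_Suc_shift[of k ?x] field_simps)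
  also have "\<dots> \<in> \<int>"
    using Suc.IH[of "Suc x"] ell_poly_Ints[of k "Suc x"] ell_poly_Ints[of "Suc k" "Suc x"]
    by (intro Ints_add Ints_diff Ints_mult) auto
  finally show ?case .
qed

theorem theorem9:
  fixes n :: nat
  assumes "n \<ge> 1"
  shows "(odd n \<longrightarrow> (\<forall>j<mdeg n. bcoef j n / of_nat n \<in> \<int>)) \<and>
    (odd n \<and> n \<ge> 3 \<longrightarrow>
      (\<forall>i. 1 \<le> i \<and> i < mdeg n \<longrightarrow>
        bcoef i n = of_nat n * (bcoef i (n - 1) + bcoef (i - 1) (n - 1)))) \<and>
    (even n \<and> n \<ge> 4 \<longrightarrow>
      (\<forall>i. 1 \<le> i \<and> i < mdeg n \<longrightarrow>
        2 * bcoef i n = bcoef i (n - 1) + bcoef (i - 1) (n - 1)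
          + fact (mdeg n) * of_nat (mdeg n choose i)))"
proof (intro conjI impI allI)
  fix j
  assume "odd n" and j: "j < mdeg n"
  then obtain k where k: "n = 2 * k + 1"
    by (auto elim: oddE)
  \<comment> \<open>For n = 1 there is no \<open>j\<close> below \<open>mdeg n\<close>, so n is at
    least 3.\<close>
  with j obtain m where "k = Suc m"
    by (cases k) (auto simp: mdeg_def)
  with k have n: "n = 2 * Suc m + 1"
    by simp
  have "j \<le> m"
    using j by (simp add: n mdeg_def)
  \<comment> \<open>The bound on \<open>j\<close> keeps the Newton index positive, so one difference
    can be taken and the factor n comes out.\<close>
  then have "bcoef j n = newton_coeff (odd_poly (Suc m)) (Suc (m - j))"
    using bcoef_odd[of j "Suc m"] by (simp only: n Suc_diff_le)
  moreover have "newton_coeff (even_poly m) k \<in> \<int>" for k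
    by (rule newton_coeff_Ints) (rule even_poly_Ints)
  moreover have "n = 2 * m + 3"
    by (simp add: n)
  ultimately show "bcoef j n / of_nat n \<in> \<int>"
    unfolding newton_coeff_odd_poly_Suc by (simp del: newton_coeff.simps)
next
  fix i
  assume "odd n \<and> 3 \<le> n" and i: "1 \<le> i \<and> i < mdeg n"
  then obtain k where k: "n = 2 * k + 1" "k \<ge> 1"
    by (auto elim!: oddE)
  define m where "m = k - 1"
  have n: "n = 2 * m + 3" "n = 2 * Suc m + 1" "n - 1 = 2 * m + 2"
    using k by (simp_all add: m_def)
  have "i \<le> m"
    using i by (simp add: n mdeg_def)
  \<comment> \<open>Here n - 1 has degree bound \<open>m\<close>, one less than
    \<open>mdeg n\<close>. Lowering \<open>i\<close> by one raises the Newton index by one;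
    \<open>1 \<le> i\<close> is essential under truncated subtraction.\<close>
  then have sub: "m - (i - 1) = Suc (m - i)"
    using i by linarith
  have "bcoef i n = newton_coeff (odd_poly (Suc m)) (Suc (m - i))"
    using bcoef_odd[of i "Suc m"] \<open>i \<le> m\<close> by (simp only: n(2) Suc_diff_le)
  moreover have "bcoef i (n - 1) = newton_coeff (even_poly m) (m - i)"
    using bcoef_even[of i m] \<open>i \<le> m\<close> by (simp only: n(3))
  moreover have "bcoef (i - 1) (n - 1) = newton_coeff (even_poly m) (Suc (m - i))"
    using bcoef_even[of "i - 1" m] \<open>i \<le> m\<close> unfolding n(3) sub by linarith
  ultimately show "bcoef i n = of_nat n * (bcoef i (n - 1) + bcoef (i - 1) (n - 1))"
    using newton_coeff_odd_poly_Suc[of m "m - i"] by (simp only: n(1))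
next
  fix i
  assume "even n \<and> 4 \<le> n" and i: "1 \<le> i \<and> i < mdeg n"
  then obtain k where k: "n = 2 * k" "k \<ge> 1"
    by (auto elim!: evenE)
  define m where "m = k - 1"
  have n: "n = 2 * m + 2" "n - 1 = 2 * m + 1" and m: "mdeg n = m"
    using k by (simp_all add: m_def mdeg_def)
  have "i \<le> m" and sub: "m - (i - 1) = Suc (m - i)"
    using i m by linarith+
  have "bcoef i n = newton_coeff (even_poly m) (m - i)"
    using bcoef_even[of i m] \<open>i \<le> m\<close> by (simp only: n(1))
  moreover have "bcoef i (n - 1) = newton_coeff (odd_poly m) (m - i)"
    using bcoef_odd[of i m] \<open>i \<le> m\<close> by (simp only: n(2))
  moreover have "bcoef (i - 1) (n - 1) = newton_coeff (odd_poly m) (Suc (m - i))"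
    using bcoef_odd[of "i - 1" m] \<open>i \<le> m\<close> unfolding n(2) sub by linarith
  ultimately show "2 * bcoef i n = bcoef i (n - 1) + bcoef (i - 1) (n - 1)
      + fact (mdeg n) * of_nat (mdeg n choose i)"
    \<comment> \<open>The Newton index m - i yields (m choose m - i); symmetry turns it into (m
      choose i).\<close>
    using newton_coeff_even_poly[of m "m - i"] binomial_symmetric[OF \<open>i \<le> m\<close>]
    by (simp only: m)
qed

end
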